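(* Let $\mathbb{F}_q$ be a finite field of odd characteristic with $q\equiv 1\pmod 6$, and let $T$ be a generator of the group of multiplicative characters of $\mathbb{F}_q$. Let $a,b,c\in\mathbb{F}_q^\times$, and suppose $h\in\mathbb{F}_q^\times$ satisfies both $$3h^2+2\,\frac{ab+bc+ca}{bc}\,h+\frac{ab+ca+a^2}{bc}=0\qquad\text{and}\qquad 3h^2+2(a+b+c)h+ab+bc+ca=0.$$ Set $$d=3h+a+b+c,\qquad e=h^3+(a+b+c)h^2+(ab+bc+ca)h+abc,$$ $$f=3h+\frac{ab+bc+ca}{bc},\qquad g=h^3+\frac{ab+bc+ca}{bc}h^2+\frac{ab+ca+a^2}{bc}h+\frac{a^2}{bc},$$ and assume that $a,b,c,d,e,f$ all lie in $\mathbb{F}_q^\times$ and are pairwise distinct. Then $$\psi_{(2,2,2)}(a,b,c)=-1+q\,\varphi(-3d)\;{_2}F_1\left(\begin{array}{cc}T^{\frac{q-1}{6}},&T^{\frac{5(q-1)}{6}}\\ &\varepsilon\end{array}\Big|\ -\frac{3^3e}{2^2d^3}\right)+q\,\varphi(bc)\,\varphi(-3f)\;{_2}F_1\left(\begin{array}{cc}T^{\frac{q-1}{6}},&T^{\frac{5(q-1)}{6}}\\ &\varepsilon\end{array}\Big|\ -\frac{3^3g}{2^2f^3}\right).$$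
   Context: Multiplicative characters $\chi:\mathbb{F}_q^\times\to\mathbb{C}^\times$ are extended to $\mathbb{F}_q$ by $\chi(0):=0$, including the trivial character $\varepsilon$; $\overline{\chi}$ is the inverse of $\chi$. $\varphi$ is the quadratic character and $\varepsilon$ the trivial character of $\mathbb{F}_q$. $\psi_{(2,2,2)}(a,b,c):=\sum_{x\in\mathbb{F}_q}\varphi(x^2+a)\varphi(x^2+b)\varphi(x^2+c)$. For characters $A,B,C$ and $x\in\mathbb{F}_q$, Greene's finite field hypergeometric series is $${_2}F_1\left(\begin{array}{cc}A,&B\\ &C\end{array}\Big|\ x\right):=\varepsilon(x)\frac{BC(-1)}{q}\sum_{y\in\mathbb{F}_q}B(y)\,\overline{B}C(1-y)\,\overline{A}(1-xy).$$ *)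

theory Defs
  imports Complex_Main "HOL-Library.Cardinality" "HOL-Computational_Algebra.Primes" "HOL-Algebra.Generated_Groups"
begin

text \<open>
  A multiplicative character is a homomorphism from the nonzero field elements to the nonzero
  complex numbers, extended by \<open>0\<close> at \<open>0\<close>. The extension is part of the object, also for the
  trivial character, so characters are total functions that are zero exactly at \<open>0\<close>.
\<close>

definition mult_char :: "('a::finite_field \<Rightarrow> complex) \<Rightarrow> bool" where
  "mult_char \<chi> \<longleftrightarrow> (\<forall>x. \<chi> x = 0 \<longleftrightarrow> x = 0) \<and> (\<forall>x y. \<chi> (x * y) = \<chi> x * \<chi> y)"

definition trivial_char :: "'a::finite_field \<Rightarrow> complex" where
  "trivial_char x = (if x = 0 then 0 else 1)"

definition quadratic_char :: "'a::finite_field \<Rightarrow> complex" where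
  "quadratic_char x = (if x = 0 then 0 else if \<exists>y. x = y ^ 2 then 1 else - 1)"

definition char_group :: "('a::finite_field \<Rightarrow> complex) monoid" where
  "char_group = \<lparr>carrier = {\<chi>. mult_char \<chi>}, mult = (\<lambda>\<chi> \<eta> x. \<chi> x * \<eta> x), one = trivial_char\<rparr>"

lemma mult_char_one: "mult_char \<chi> \<Longrightarrow> \<chi> 1 = 1"
  unfolding mult_char_def by (metis mult_cancel_left1 mult_1 zero_neq_one)

lemma mult_char_inverse: "mult_char \<chi> \<Longrightarrow> mult_char (\<lambda>x. inverse (\<chi> x))"
  unfolding mult_char_def by simp

lemma group_char_group: "comm_group (char_group :: ('a::finite_field \<Rightarrow> complex) monoid)"
proof (rule comm_groupI)
  fix \<chi> :: "'a \<Rightarrow> complex"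
  assume \<chi>: "\<chi> \<in> carrier char_group"
  show "\<one>\<^bsub>char_group\<^esub> \<otimes>\<^bsub>char_group\<^esub> \<chi> = \<chi>"
    using \<chi> by (auto simp: char_group_def mult_char_def trivial_char_def)
  show "\<exists>\<eta>\<in>carrier char_group. \<eta> \<otimes>\<^bsub>char_group\<^esub> \<chi> = \<one>\<^bsub>char_group\<^esub>"
    using \<chi> mult_char_inverse[of \<chi>]
    by (intro bexI[of _ "\<lambda>x. inverse (\<chi> x)"])
       (auto simp: char_group_def mult_char_def trivial_char_def)
qed (auto simp: char_group_def mult_char_def trivial_char_def mult_ac)

lemma inv_char_group:
  assumes "mult_char \<chi>"
  shows "inv\<^bsub>char_group\<^esub> \<chi> = (\<lambda>x. inverse (\<chi> x))"
proof (rule group.inv_equality)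
  show "group char_group"
    using group_char_group by (rule comm_group.axioms(2))
  show "(\<lambda>x. inverse (\<chi> x)) \<otimes>\<^bsub>char_group\<^esub> \<chi> = \<one>\<^bsub>char_group\<^esub>"
    using assms by (auto simp: char_group_def mult_char_def trivial_char_def)
qed (use assms mult_char_inverse[OF assms] in \<open>auto simp: char_group_def\<close>)

definition psi_222 :: "'a::finite_field \<Rightarrow> 'a \<Rightarrow> 'a \<Rightarrow> complex" where
  "psi_222 a b c =
     (\<Sum>x\<in>UNIV. quadratic_char (x ^ 2 + a) * quadratic_char (x ^ 2 + b) * quadratic_char (x ^ 2 + c))"

text \<open>
  Greene's series, with upper characters \<open>A\<close>, \<open>B\<close> and lower character \<open>C\<close>. Products and
  inverses of characters are taken in the character group.
\<close>

definition hyp_2F1 ::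
  "('a::finite_field \<Rightarrow> complex) \<Rightarrow> ('a \<Rightarrow> complex) \<Rightarrow> ('a \<Rightarrow> complex) \<Rightarrow> 'a \<Rightarrow> complex" where
  "hyp_2F1 A B C x =
     trivial_char x * ((B \<otimes>\<^bsub>char_group\<^esub> C) (- 1) / of_nat CARD('a)) *
     (\<Sum>y\<in>UNIV. B y * (inv\<^bsub>char_group\<^esub> B \<otimes>\<^bsub>char_group\<^esub> C) (1 - y) *
        (inv\<^bsub>char_group\<^esub> A) (1 - x * y))"

end

theory Submission
  imports Defs "HOL-Algebra.Algebraic_Closure_Type" "HOL-Algebra.Multiplicative_Group"
begin

text \<open>
  Let \<open>A\<close> be \<open>T\<close> to the power \<open>(q - 1) / 6\<close>, so that \<open>A ^ 3\<close> is the quadratic character \<open>\<phi>\<close> and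
  \<open>A ^ 4\<close> is a cubic character. Splitting the sum over \<open>x\<close> by the value \<open>t = x\<^sup>2\<close> produces the two
  sums of \<open>\<phi>\<close> over the cubics \<open>(t + a)(t + b)(t + c)\<close> and \<open>(r + 1)(r + a/b)(r + a/c)\<close>, and \<open>h\<close>
  is a common critical point of both, so a translation by \<open>h\<close> removes the linear terms. It remains
  to evaluate the sum of \<open>\<phi> (x\<^sup>3 + d x\<^sup>2 + e)\<close>.

  After scaling to \<open>d = 1\<close>, Cardano's formula parametrises \<open>x\<^sup>2 (x + 1) = t\<close> by
  \<open>t = (w + 1)\<^sup>2 / (27 w)\<close> with \<open>w\<close> a cube, which turns the sum into
  \<open>\<phi> 3\<close> times the sum of \<open>A w * \<phi> ((w + 1)\<^sup>2 - 4 \<mu> w)\<close> with \<open>\<mu> = - 27 e / 4\<close>. The argument of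
  \<open>\<phi>\<close> is the discriminant in \<open>y\<close> of \<open>w y (1 - \<mu> y) = 1 - y\<close>, and solving this equation for
  \<open>w\<close> instead gives Greene's sum.
\<close>

subsection \<open>Primitive roots and characters of finite fields\<close>

lemma card_finite_field_gt_1: "CARD('a::finite_field) > 1"
  using card_mono[of UNIV "{0, 1 :: 'a}"] by simp

lemma finite_field_power_card_minus_1:
  fixes x :: "'a::finite_field"
  assumes "x \<noteq> 0"
  shows "x ^ (CARD('a) - 1) = 1"
proof -
  have "x * x ^ (CARD('a) - 1) = x ^ CARD('a)"
    by (metis One_nat_def Suc_pred power_Suc zero_less_card_finite)
  thus ?thesis using assms finite_field_power_card_eq_same[of x] by simp
qed

text \<open>The unit group of a finite field is cyclic. The third property says that the order of
  \<open>r\<close> is exactly \<open>CARD('a) - 1\<close>; it follows by counting powers.\<close>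

lemma finite_field_primitive_root:
  obtains r :: "'a::finite_field"
  where "r \<noteq> 0" "\<And>x. x \<noteq> 0 \<Longrightarrow> \<exists>k. x = r ^ k"
    "\<And>n. r ^ n = 1 \<Longrightarrow> (CARD('a) - 1) dvd n"
proof -
  \<comment> \<open>Cyclicity is stated for record-based fields, so the type is wrapped as a ring
    record; \<open>pow\<close> and \<open>carrier\<close> translate the result back.\<close>
  define R where "R = (ring_of_type_algebra :: 'a ring)"
  interpret R: field R unfolding R_def by (rule field_from_type_algebra)
  have pow: "x [^]\<^bsub>R\<^esub> (i::nat) = x ^ i" for x :: 'a and i
    by (induction i) (simp_all add: R_def ring_of_type_algebra_def mult.commute)
  have carrier: "carrier R = UNIV" "\<zero>\<^bsub>R\<^esub> = 0"
    by (simp_all add: R_def ring_of_type_algebra_def)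
  have "\<exists>r \<in> - {0 :: 'a}. - {0} = {r ^ i | i::nat. i \<in> UNIV}"
    using R.finite_field_mult_group_has_gen
    by (simp add: carrier pow Compl_eq_Diff_UNIV)
  then obtain r :: 'a where r: "r \<noteq> 0" "- {0} = {r ^ i | i::nat. i \<in> UNIV}"
    by blast
  have ex: "\<exists>k. x = r ^ k" if "x \<noteq> 0" for x
    using that r(2) by blast
  \<comment> \<open>If \<open>r ^ n = 1\<close>, the powers with exponent below \<open>n\<close>
    already exhaust the nonzero elements.\<close>
  have large: "CARD('a) - 1 \<le> n" if "r ^ n = 1" "n > 0" for n
  proof -
    have "- {0} \<subseteq> (\<lambda>k. r ^ k) ` {..<n}"
    proof
      fix x :: 'a assume "x \<in> - {0}"
      then obtain k where k: "x = r ^ k" using ex by blast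
      have "r ^ k = r ^ (n * (k div n) + k mod n)" by simp
      also have "\<dots> = r ^ (k mod n)"
        unfolding power_add power_mult that by simp
      finally show "x \<in> (\<lambda>k. r ^ k) ` {..<n}" using k that by auto
    qed
    hence "card (- {0 :: 'a}) \<le> card {..<n}"
      by (meson card_image_le card_mono finite_imageI finite_lessThan le_trans)
    thus ?thesis by (simp add: Compl_eq_Diff_UNIV card_Diff_singleton)
  qed
  have "(CARD('a) - 1) dvd n" if "r ^ n = 1" for n
  proof (rule ccontr)
    let ?N = "CARD('a) - 1"
    assume "\<not> ?N dvd n"
    hence pos: "n mod ?N > 0" by (simp add: mod_greater_zero_iff_not_dvd)
    have N: "?N > 0" using card_finite_field_gt_1[where 'a='a] by simp
    have "r ^ n = r ^ (?N * (n div ?N) + n mod ?N)" by simp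
    also have "\<dots> = r ^ (n mod ?N)"
      unfolding power_add power_mult finite_field_power_card_minus_1[OF r(1)] by simp
    finally have "?N \<le> n mod ?N" using large pos that by simp
    moreover have "n mod ?N < ?N" using N by simp
    ultimately show False by simp
  qed
  thus thesis using that r(1) ex by blast
qed

section \<open>Characters as functions and as group elements\<close>

lemma mult_char_mult: "mult_char \<chi> \<Longrightarrow> \<chi> (x * y) = \<chi> x * \<chi> y"
  by (simp add: mult_char_def)

lemma mult_char_zero_iff: "mult_char \<chi> \<Longrightarrow> \<chi> x = 0 \<longleftrightarrow> x = 0"
  by (simp add: mult_char_def)

lemma mult_char_power: "mult_char \<chi> \<Longrightarrow> \<chi> (x ^ n) = \<chi> x ^ n"
  by (induction n) (simp_all add: mult_char_one mult_char_mult)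

text \<open>The case \<open>n = 0\<close> has to be excluded: the zeroth group power is
  \<open>trivial_char\<close>, which vanishes at 0, while the pointwise power would be 1
  there.\<close>

lemma char_group_nat_pow:
  assumes "\<chi> \<in> carrier char_group" "n > 0"
  shows "\<chi> [^]\<^bsub>char_group\<^esub> (n::nat) = (\<lambda>x. \<chi> x ^ n)"
  using assms(2)
proof (induction n rule: nat_induct_non_zero)
  case 1
  show ?case using assms(1)
    by (auto simp: char_group_def mult_char_def trivial_char_def fun_eq_iff)
next
  case (Suc n)
  thus ?case
    by (simp add: nat_pow_Suc) (simp add: char_group_def mult.commute)
qed

text \<open>All characters are powers of \<open>T\<close>, and some character has trivial kernel.\<close>
lemma char_group_generator_faithful:
  fixes T :: "'a::finite_field \<Rightarrow> complex"
  assumes T: "T \<in> carrier char_group"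
    and gen: "generate char_group {T} = carrier char_group"
    and x: "T x = 1"
  shows "x = 1"
proof -
  have T': "mult_char T" using T by (simp add: char_group_def)
  have x0: "x \<noteq> 0" using x T' by (metis mult_char_zero_iff zero_neq_one)
  have all: "\<chi> x = 1" if "\<chi> \<in> carrier char_group" for \<chi>
  proof -
    have "\<chi> \<in> generate char_group {T}" using that gen by simp
    thus ?thesis
    proof induction
      case one
      show ?case using x0 by (simp add: char_group_def trivial_char_def)
    next
      case (inv h)
      thus ?case using x by (simp add: inv_char_group[OF T'])
    next
      case (eng h1 h2)
      thus ?case by (simp add: char_group_def)
    qed (use x in simp)
  qed
  obtain r :: 'a where r: "r \<noteq> 0" "\<And>x. x \<noteq> 0 \<Longrightarrow> \<exists>k. x = r ^ k"
    "\<And>n. r ^ n = 1 \<Longrightarrow> (CARD('a) - 1) dvd n"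
    using finite_field_primitive_root by blast
  define N where "N = CARD('a) - 1"
  \<comment> \<open>A primitive \<open>N\<close>-th root of unity; the character with
    \<open>r\<close> mapped to \<open>\<zeta>\<close> is the one with trivial kernel.\<close>
  define \<zeta> where "\<zeta> = cis (2 * pi / N)"
  have N: "N > 0"
    using card_finite_field_gt_1[where 'a='a] by (simp add: N_def)
  have \<zeta>N: "\<zeta> ^ N = 1" using N by (simp add: \<zeta>_def DeMoivre)
  have \<zeta>0: "\<zeta> \<noteq> 0" by (simp add: \<zeta>_def)
  have rN: "r ^ N = 1" unfolding N_def using r(1) by (rule finite_field_power_card_minus_1)
  have \<zeta>1: "N dvd k" if "\<zeta> ^ k = 1" for k
  proof -
    have "\<zeta> ^ k = \<zeta> ^ (N * (k div N) + k mod N)" by simp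
    also have "\<dots> = \<zeta> ^ (k mod N)" unfolding power_add power_mult \<zeta>N by simp
    finally have "cis (2 * pi * real (k mod N) / N) = 1"
      using that by (simp add: \<zeta>_def DeMoivre field_simps)
    hence "cos (2 * pi * real (k mod N) / N) = 1" by (simp add: complex_eq_iff)
    then obtain j :: int where "2 * pi * real (k mod N) / N = real_of_int j * 2 * pi"
      using cos_one_2pi_int by blast
    hence "real (k mod N) = real_of_int j * N" using N by (simp add: field_simps)
    hence "int (k mod N) = j * int N"
      by (metis of_int_eq_iff of_int_mult of_int_of_nat_eq)
    hence "int N dvd int (k mod N)" by simp
    thus ?thesis by (simp add: dvd_mod_iff)
  qed
  \<comment> \<open>A discrete logarithm to base \<open>r\<close>. Its arbitrary choice is harmless:
    by \<open>eq\<close> below, \<open>\<zeta> ^ k\<close> depends only on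
    \<open>r ^ k\<close>.\<close>
  define e where "e y = (SOME k. y = r ^ k)" for y
  have e: "y = r ^ e y" if "y \<noteq> 0" for y
    unfolding e_def using r(2)[OF that] by (rule someI_ex)
  define \<chi> where "\<chi> y = (if y = 0 then 0 else \<zeta> ^ e y)" for y
  have eq: "\<zeta> ^ k = \<zeta> ^ l" if "r ^ k = r ^ l" for k l
  proof -
    have *: "\<zeta> ^ k = \<zeta> ^ l" if "r ^ k = r ^ l" "k \<le> l" for k l
    proof -
      have "r ^ k * r ^ (l - k) = r ^ k"
        using that by (metis le_add_diff_inverse power_add)
      hence "r ^ (l - k) = 1" using r(1) by simp
      hence "N dvd l - k" using r(3) by (simp add: N_def)
      then obtain j where j: "l - k = N * j" by blast
      have "\<zeta> ^ l = \<zeta> ^ (k + N * j)"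
        using that by (simp flip: j)
      also have "\<dots> = \<zeta> ^ k" unfolding power_add power_mult \<zeta>N by simp
      finally show ?thesis by simp
    qed
    show ?thesis using *[of k l] *[of l k] that nat_le_linear[of k l] by metis
  qed
  have "\<chi> (y * z) = \<chi> y * \<chi> z" for y z
  proof (cases "y = 0 \<or> z = 0")
    case False
    hence "r ^ e (y * z) = r ^ (e y + e z)"
      using e[of y] e[of z] e[of "y * z"] by (simp add: power_add)
    from eq[OF this] show ?thesis using False by (simp add: \<chi>_def power_add)
  qed (auto simp: \<chi>_def)
  hence "\<chi> \<in> carrier char_group"
    using \<zeta>0 by (auto simp: char_group_def mult_char_def \<chi>_def)
  hence "\<zeta> ^ e x = 1" using all[of \<chi>] x0 by (simp add: \<chi>_def)
  hence "N dvd e x" by (rule \<zeta>1)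
  then obtain j where "e x = N * j" by blast
  hence "r ^ e x = 1" by (simp add: power_mult rN)
  thus ?thesis using e[OF x0] by simp
qed

subsection \<open>Sums of the quadratic character\<close>

lemma quadratic_char_square [simp]: "x \<noteq> 0 \<Longrightarrow> quadratic_char (x ^ 2) = 1"
  by (auto simp: quadratic_char_def)

lemma quadratic_char_zero [simp]: "quadratic_char 0 = 0"
  by (simp add: quadratic_char_def)

lemma quadratic_char_values: "quadratic_char x \<in> {0, 1, - 1}"
  by (simp add: quadratic_char_def)

lemma quadratic_char_mult_square:
  assumes "u \<noteq> 0"
  shows "quadratic_char (u ^ 2 * x) = quadratic_char x"
proof -
  have "(\<exists>y. u ^ 2 * x = y ^ 2) \<longleftrightarrow> (\<exists>y. x = y ^ 2)"
  proof
    assume "\<exists>y. u ^ 2 * x = y ^ 2"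
    then obtain y where "u ^ 2 * x = y ^ 2" by blast
    hence "x = (y / u) ^ 2" using assms by (simp add: field_simps)
    thus "\<exists>y. x = y ^ 2" by blast
  qed (metis power_mult_distrib)
  thus ?thesis using assms by (simp add: quadratic_char_def)
qed

lemma card_square_roots:
  fixes x :: "'a::finite_field"
  assumes two: "(2 :: 'a) \<noteq> 0"
  shows "of_nat (card {y. y ^ 2 = x}) = 1 + quadratic_char x"
proof (cases "\<exists>y. x = y ^ 2")
  case True
  then obtain y where y: "x = y ^ 2" by blast
  have eq: "{z. z ^ 2 = x} = {y, - y}" by (auto simp: y power2_eq_iff)
  have "y \<noteq> - y" if "y \<noteq> 0"
  proof
    assume "y = - y"
    hence "2 * y = 0" by (metis add.right_inverse mult_2)
    thus False using that two by simp
  qed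
  thus ?thesis unfolding eq by (cases "y = 0") (auto simp: y)
next
  case False
  hence "{y. y ^ 2 = x} = {}" by blast
  moreover have "x \<noteq> 0" using False by (metis zero_power2)
  ultimately show ?thesis using False by (simp add: quadratic_char_def)
qed

text \<open>Completing the square turns the roots into square roots of the discriminant.\<close>

lemma card_quadratic_roots:
  fixes a b c :: "'a::finite_field"
  assumes two: "(2 :: 'a) \<noteq> 0" and a: "a \<noteq> 0"
  shows "of_nat (card {x. a * x ^ 2 + b * x + c = 0}) = 1 + quadratic_char (b ^ 2 - 4 * a * c)"
proof -
  have four: "4 * a \<noteq> 0" using two a mult_eq_0_iff[of "2 :: 'a" 2] by simp
  have iff: "a * x ^ 2 + b * x + c = 0 \<longleftrightarrow> (2 * a * x + b) ^ 2 = b ^ 2 - 4 * a * c" for x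
  proof -
    have "(2 * a * x + b) ^ 2 - (b ^ 2 - 4 * a * c) = 4 * a * (a * x ^ 2 + b * x + c)"
      by (simp add: algebra_simps power2_eq_square)
    thus ?thesis using four by (metis eq_iff_diff_eq_0 mult_eq_0_iff)
  qed
  have "bij_betw (\<lambda>x. 2 * a * x + b) {x. a * x ^ 2 + b * x + c = 0} {y. y ^ 2 = b ^ 2 - 4 * a * c}"
    by (rule bij_betw_byWitness[where f' = "\<lambda>y. (y - b) / (2 * a)"])
       (use two a in \<open>auto simp: iff\<close>)
  hence "card {x. a * x ^ 2 + b * x + c = 0} = card {y. y ^ 2 = b ^ 2 - 4 * a * c}"
    by (rule bij_betw_same_card)
  thus ?thesis using card_square_roots[OF two] by simp
qed

section \<open>Regrouping and reindexing of sums\<close>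

lemma sum_fibres:
  fixes f :: "'a::finite \<Rightarrow> 'b::finite" and G :: "'b \<Rightarrow> 'c::comm_semiring_1"
  shows "(\<Sum>x\<in>S. G (f x)) = (\<Sum>y\<in>UNIV. of_nat (card {x\<in>S. f x = y}) * G y)"
proof -
  have "(\<Sum>x\<in>S. G (f x)) = (\<Sum>y\<in>UNIV. \<Sum>x\<in>{x\<in>S. f x = y}. G (f x))"
    by (rule sum.group[symmetric]) auto
  also have "\<dots> = (\<Sum>y\<in>UNIV. of_nat (card {x\<in>S. f x = y}) * G y)"
    by (intro sum.cong) simp_all
  finally show ?thesis .
qed

lemma sum_affine:
  fixes F :: "'a::finite_field \<Rightarrow> 'b::comm_monoid_add"
  assumes "u \<noteq> 0"
  shows "(\<Sum>x\<in>UNIV. F (u * x + v)) = (\<Sum>x\<in>UNIV. F x)"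
  by (rule sum.reindex_bij_witness[of _ "\<lambda>y. (y - v) / u" "\<lambda>x. u * x + v"]) (use assms in auto)

text \<open>The equation \<open>s + 1 / s = y\<close> is the quadratic
  \<open>s ^ 2 - y * s + 1 = 0\<close> of discriminant \<open>y ^ 2 - 4\<close>, and 0 is never a
  root of it.\<close>

lemma sum_add_inverse:
  fixes G :: "'a::finite_field \<Rightarrow> complex"
  assumes two: "(2 :: 'a) \<noteq> 0"
  shows "(\<Sum>s\<in>-{0}. G (s + 1 / s)) = (\<Sum>y\<in>UNIV. (1 + quadratic_char (y ^ 2 - 4)) * G y)"
proof -
  have "{s \<in> - {0}. s + 1 / s = y} = {s. 1 * s ^ 2 + (- y) * s + 1 = 0}" for y :: 'a
    by (auto simp: divide_simps power2_eq_square algebra_simps eq_neg_iff_add_eq_0)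
  hence "of_nat (card {s \<in> - {0}. s + 1 / s = y}) = 1 + quadratic_char (y ^ 2 - 4)" for y :: 'a
    using card_quadratic_roots[OF two, of 1 "- y" 1] by simp
  thus ?thesis by (subst sum_fibres) simp
qed

text \<open>Taking \<open>G = 1\<close> in \<open>sum_add_inverse\<close> counts the nonzero
  elements in two ways.\<close>

lemma sum_quadratic_char_square_minus_4:
  assumes two: "(2 :: 'a::finite_field) \<noteq> 0"
  shows "(\<Sum>y\<in>(UNIV :: 'a set). quadratic_char (y ^ 2 - 4)) = - 1"
proof -
  have "of_nat (CARD('a) - 1) = (\<Sum>y\<in>(UNIV :: 'a set). 1 + quadratic_char (y ^ 2 - 4))"
    using sum_add_inverse[OF two, of "\<lambda>_. 1"]
    by (simp add: Compl_eq_Diff_UNIV card_Diff_singleton)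
  thus ?thesis by (simp add: sum.distrib of_nat_diff Suc_leI)
qed

lemma sum_quadratic_char:
  assumes two: "(2 :: 'a::finite_field) \<noteq> 0"
  shows "(\<Sum>x\<in>(UNIV :: 'a set). quadratic_char x) = 0"
proof -
  have "of_nat CARD('a) = (\<Sum>x\<in>(UNIV :: 'a set). 1 + quadratic_char x)"
    using sum_fibres[of "\<lambda>_. 1 :: complex" "\<lambda>y :: 'a. y ^ 2" UNIV]
    by (simp add: card_square_roots[OF two])
  thus ?thesis by (simp add: sum.distrib)
qed

text \<open>Up to square factors and the square -3, the argument on the right is the discriminant of
  the cubic \<open>X ^ 2 * (X + 1) - t\<close>, and the one at a root \<open>x\<close> is the
  discriminant of its quadratic cofactor. A simple root thus contributes 0 if the cofactor splits
  with distinct roots and 2 if it is irreducible.\<close>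

lemma cubic_fibre_nonempty:
  fixes t u x\<^sub>0 :: "'a::finite_field"
  assumes two: "(2 :: 'a) \<noteq> 0" and three: "(3 :: 'a) \<noteq> 0" and u: "u ^ 2 = (- 3 :: 'a)"
    and x\<^sub>0: "x\<^sub>0 ^ 2 * (x\<^sub>0 + 1) = t"
  shows "(\<Sum>x | x ^ 2 * (x + 1) = t. 1 - quadratic_char ((3 * x + 1) ^ 2 - 4)) =
    1 - quadratic_char ((27 * t - 2) ^ 2 - 4)"
proof -
  have u0: "u \<noteq> 0" using u three by auto
  have \<Delta>: "quadratic_char ((3 * x + 1) ^ 2 - 4) = quadratic_char ((x + 1) * (1 - 3 * x))" for x :: 'a
  proof -
    have "(3 * x + 1) ^ 2 - 4 = u ^ 2 * ((x + 1) * (1 - 3 * x))" unfolding u by (simp add: algebra_simps power2_eq_square)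
    thus ?thesis using quadratic_char_mult_square[OF u0] by simp
  qed
  have 27: "(27 :: 'a) \<noteq> 0" using three power_not_zero[of "3 :: 'a" 3] by simp
  have m3: "quadratic_char (- 3 :: 'a) = 1" using quadratic_char_square[OF u0] u by simp
  \<comment> \<open>The first two values of \<open>t\<close> are those for which the cubic has a
    double root.\<close>
  consider "t = 0" | "27 * t = 4" | "t \<noteq> 0" "27 * t \<noteq> 4" by blast
  thus ?thesis
  proof cases
    case 1
    have "{x. x ^ 2 * (x + 1) = t} = {0, - 1}" by (auto simp: 1 add_eq_0_iff2)
    thus ?thesis using m3 by (simp add: 1)
  next
    case 2
    have "27 * (x ^ 2 * (x + 1) - t) = (3 * x - 1) * (3 * x + 2) ^ 2" for x :: 'a
    proof -
      have "27 * (x ^ 2 * (x + 1) - t) = 27 * (x ^ 2 * (x + 1)) - 27 * t"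
        by (simp add: right_diff_distrib)
      also have "\<dots> = (3 * x - 1) * (3 * x + 2) ^ 2"
        unfolding 2 by (simp add: algebra_simps power2_eq_square)
      finally show ?thesis .
    qed
    hence "x ^ 2 * (x + 1) - t = 0 \<longleftrightarrow> (3 * x - 1) * (3 * x + 2) ^ 2 = 0" for x :: 'a
      using 27 by (metis mult_eq_0_iff)
    moreover have "(3 * x - 1) * (3 * x + 2) ^ 2 = 0 \<longleftrightarrow> 3 * x - 1 = 0 \<or> 3 * x + 2 = 0" for x :: 'a
      by simp
    moreover define r s :: 'a where "r = 1 / 3" and "s = - 2 / 3"
    have rs: "3 * r = 1" "3 * s = - 2" using three by (simp_all add: r_def s_def)
    have "3 * x - 1 = 0 \<longleftrightarrow> x = r" for x
      using three rs(1) by (metis eq_iff_diff_eq_0 mult_left_cancel)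
    moreover have "3 * x + 2 = 0 \<longleftrightarrow> x = s" for x
      using three rs(2) by (metis eq_neg_iff_add_eq_0 mult_left_cancel)
    ultimately have "x ^ 2 * (x + 1) - t = 0 \<longleftrightarrow> x = r \<or> x = s" for x :: 'a
      by metis
    hence "{x. x ^ 2 * (x + 1) = t} = {r, s}"
      by (auto simp only: eq_iff_diff_eq_0[of _ t])
    moreover have "r \<noteq> s"
    proof
      assume "r = s"
      hence "(1 :: 'a) = - 2" using rs by metis
      thus False unfolding eq_neg_iff_add_eq_0 using three by simp
    qed
    ultimately show ?thesis using m3 by (simp add: 2 rs)
  next
    case 3
    \<comment> \<open>\<open>Q\<close> is the zero set of the cofactor. The cofactor takes the value
      \<open>x\<^sub>0 * (3 * x\<^sub>0 + 2)\<close>, the derivative of the cubic, at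
      \<open>x\<^sub>0\<close>, so \<open>x\<^sub>0\<close> is a simple root.\<close>
    define Q where "Q = {y. y ^ 2 + (x\<^sub>0 + 1) * y + x\<^sub>0 ^ 2 + x\<^sub>0 = 0}"
    have "x\<^sub>0 \<noteq> 0" using 3 x\<^sub>0 by auto
    moreover have "3 * x\<^sub>0 + 2 \<noteq> 0"
    proof
      assume "3 * x\<^sub>0 + 2 = 0"
      moreover have "27 * t - 4 = (3 * x\<^sub>0 - 1) * (3 * x\<^sub>0 + 2) ^ 2"
        unfolding x\<^sub>0[symmetric] by (simp add: algebra_simps power2_eq_square)
      ultimately show False using 3 by simp
    qed
    ultimately have nz: "3 * x\<^sub>0 * (3 * x\<^sub>0 + 2) \<noteq> 0" using three by simp
    have notin: "x\<^sub>0 \<notin> Q"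
    proof
      assume "x\<^sub>0 \<in> Q"
      hence "x\<^sub>0 * (3 * x\<^sub>0 + 2) = 0" by (simp add: Q_def algebra_simps power2_eq_square)
      thus False using nz by simp
    qed
    have "x ^ 2 * (x + 1) - t = (x - x\<^sub>0) * (x ^ 2 + (x\<^sub>0 + 1) * x + x\<^sub>0 ^ 2 + x\<^sub>0)" for x :: 'a
      unfolding x\<^sub>0[symmetric] by (simp add: algebra_simps power2_eq_square)
    hence roots: "{x. x ^ 2 * (x + 1) = t} = insert x\<^sub>0 Q"
      unfolding Q_def by (auto simp: eq_iff_diff_eq_0[of _ t])
    have E: "quadratic_char ((3 * y + 1) ^ 2 - 4) = 1" if y: "y \<in> Q" for y
    proof -
      \<comment> \<open>The third root. The cofactor at \<open>y\<close> has roots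
        \<open>x\<^sub>0\<close> and \<open>z\<close>, so its discriminant is the nonzero square
        \<open>(x\<^sub>0 - z) ^ 2\<close>.\<close>
      define z where "z = - (x\<^sub>0 + 1) - y"
      have y': "y ^ 2 + (x\<^sub>0 + 1) * y + x\<^sub>0 ^ 2 + x\<^sub>0 = 0" using y by (simp add: Q_def)
      have "z ^ 2 + (x\<^sub>0 + 1) * z + x\<^sub>0 ^ 2 + x\<^sub>0 = y ^ 2 + (x\<^sub>0 + 1) * y + x\<^sub>0 ^ 2 + x\<^sub>0"
        by (simp add: z_def algebra_simps power2_eq_square)
      hence "x\<^sub>0 - z \<noteq> 0" using notin y' by (auto simp: Q_def)
      moreover have "(y + 1) * (1 - 3 * y) =
          (x\<^sub>0 - z) ^ 2 - 4 * (y ^ 2 + (x\<^sub>0 + 1) * y + x\<^sub>0 ^ 2 + x\<^sub>0)"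
        by (simp add: z_def algebra_simps power2_eq_square)
      hence "(y + 1) * (1 - 3 * y) = (x\<^sub>0 - z) ^ 2" unfolding y' by simp
      ultimately show ?thesis by (simp add: \<Delta>)
    qed
    \<comment> \<open>The discriminant of the cubic is that of the cofactor times the squared
      derivative at \<open>x\<^sub>0\<close>.\<close>
    have "(27 * t - 2) ^ 2 - 4 =
        (3 * x\<^sub>0 * (3 * x\<^sub>0 + 2)) ^ 2 * ((3 * x\<^sub>0 + 1) ^ 2 - 4)"
      unfolding x\<^sub>0[symmetric] by (simp add: algebra_simps power2_eq_square)
    hence "quadratic_char ((27 * t - 2) ^ 2 - 4) = quadratic_char ((3 * x\<^sub>0 + 1) ^ 2 - 4)"
      using quadratic_char_mult_square[OF nz] by simp
    thus ?thesis unfolding roots using notin by (simp add: E)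
  qed
qed

text \<open>
  A form of Stickelberger's parity theorem for fibres without a root, too: by the nonempty case the
  difference of the two sides is nonnegative for every \<open>t\<close>, and it sums to zero over all \<open>t\<close>.
\<close>
lemma cubic_fibre:
  fixes t u :: "'a::finite_field"
  assumes two: "(2 :: 'a) \<noteq> 0" and three: "(3 :: 'a) \<noteq> 0" and u: "u ^ 2 = (- 3 :: 'a)"
  shows "(\<Sum>x | x ^ 2 * (x + 1) = t. 1 - quadratic_char ((3 * x + 1) ^ 2 - 4)) =
    1 - quadratic_char ((27 * t - 2) ^ 2 - 4)"
proof -
  define \<delta> :: "'a \<Rightarrow> complex" where
    "\<delta> t = 1 - quadratic_char ((27 * t - 2) ^ 2 - 4) -
      (\<Sum>x | x ^ 2 * (x + 1) = t. 1 - quadratic_char ((3 * x + 1) ^ 2 - 4))" for t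
  have 27: "(27 :: 'a) \<noteq> 0" using three power_not_zero[of "3 :: 'a" 3] by simp
  have cases: "\<delta> t = 0 \<or> \<delta> t = 1 \<or> \<delta> t = 2" for t
  proof (cases "\<exists>x. x ^ 2 * (x + 1) = t")
    case True
    then obtain x where "x ^ 2 * (x + 1) = t" by blast
    from cubic_fibre_nonempty[OF two three u this] show ?thesis by (simp add: \<delta>_def)
  next
    case False
    hence "{x. x ^ 2 * (x + 1) = t} = {}" by blast
    thus ?thesis
      using quadratic_char_values[of "(27 * t - 2) ^ 2 - 4"] by (auto simp: \<delta>_def)
  qed
  have "(\<Sum>t\<in>(UNIV :: 'a set). quadratic_char ((27 * t - 2) ^ 2 - 4)) = - 1"
    using sum_affine[OF 27, of "\<lambda>y. quadratic_char (y ^ 2 - 4)" "- 2"]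
    by (simp add: sum_quadratic_char_square_minus_4[OF two])
  moreover have "(\<Sum>t\<in>(UNIV :: 'a set). \<Sum>x | x ^ 2 * (x + 1) = t. 1 - quadratic_char ((3 * x + 1) ^ 2 - 4)) =
      (\<Sum>x\<in>UNIV. 1 - quadratic_char ((3 * x + 1 :: 'a) ^ 2 - 4))"
    using sum.group[of "UNIV :: 'a set" UNIV "\<lambda>x. x ^ 2 * (x + 1)"
        "\<lambda>x. 1 - quadratic_char ((3 * x + 1) ^ 2 - 4)"] by simp
  moreover have "(\<Sum>x\<in>UNIV. quadratic_char ((3 * x + 1 :: 'a) ^ 2 - 4)) = - 1"
    using sum_affine[OF three, of "\<lambda>y. quadratic_char (y ^ 2 - 4)" 1]
    by (simp add: sum_quadratic_char_square_minus_4[OF two])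
  ultimately have "(\<Sum>t\<in>UNIV. \<delta> t) = 0" by (simp add: \<delta>_def sum_subtractf)
  \<comment> \<open>A vanishing sum of nonnegative terms is a statement about reals, so the argument
    passes through real parts.\<close>
  hence "Re (\<Sum>t\<in>UNIV. \<delta> t) = 0" by simp
  hence "(\<Sum>t\<in>UNIV. Re (\<delta> t)) = 0" by simp
  moreover have "Re (\<delta> t) \<ge> 0" for t using cases[of t] by auto
  ultimately have "Re (\<delta> t) = 0" by (simp add: sum_nonneg_eq_0_iff)
  hence "\<delta> t = 0" using cases[of t] by auto
  thus ?thesis by (simp add: \<delta>_def)
qed

subsection \<open>The character of order six\<close>

locale generating_char =
  fixes T :: "'a::finite_field \<Rightarrow> complex" and m :: nat and A :: "'a \<Rightarrow> complex"
  assumes card: "CARD('a) = 6 * m + 1"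
    and T_char: "T \<in> carrier char_group"
    and T_gen: "generate char_group {T} = carrier char_group"
  defines "A \<equiv> \<lambda>x. T x ^ m"
begin

lemma m_pos: "m > 0"
  using card card_finite_field_gt_1[where 'a='a] by simp

lemma T_mult_char: "mult_char T"
  using T_char by (simp add: char_group_def)

text \<open>With this, \<open>A x ^ n = 1\<close> becomes the field equation
  \<open>x ^ (m * n) = 1\<close>, a divisibility condition on the discrete logarithm of
  \<open>x\<close>.\<close>

lemma T_eq_1_iff: "T x = 1 \<longleftrightarrow> x = 1"
  using char_group_generator_faithful[OF T_char T_gen] mult_char_one[OF T_mult_char] by auto

lemma T_power: "T x ^ n = T (x ^ n)"
  by (simp add: mult_char_power[OF T_mult_char])

lemma fermat: "x ^ (6 * m) = 1" if "x \<noteq> 0" for x :: 'a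
  using finite_field_power_card_minus_1[OF that] by (simp add: card)

lemma A_mult_char: "mult_char A"
  using T_mult_char m_pos by (simp add: mult_char_def A_def power_mult_distrib)

lemma A_power: "A x ^ n = T (x ^ (m * n))"
  by (simp add: A_def T_power flip: power_mult)

lemmas A_mult = mult_char_mult[OF A_mult_char]
lemmas A_one = mult_char_one[OF A_mult_char]
lemmas A_zero_iff = mult_char_zero_iff[OF A_mult_char]

lemma A_zero [simp]: "A 0 = 0"
  by (simp add: A_zero_iff)

lemma primitive_root:
  obtains r :: 'a where "r \<noteq> 0" "\<And>x. x \<noteq> 0 \<Longrightarrow> \<exists>k. x = r ^ k"
    "\<And>n. r ^ n = 1 \<longleftrightarrow> 6 * m dvd n"
proof -
  obtain r :: 'a where r: "r \<noteq> 0" "\<And>x. x \<noteq> 0 \<Longrightarrow> \<exists>k. x = r ^ k"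
    "\<And>n. r ^ n = 1 \<Longrightarrow> (CARD('a) - 1) dvd n"
    using finite_field_primitive_root by blast
  have "r ^ n = 1 \<longleftrightarrow> 6 * m dvd n" for n
  proof
    show "r ^ n = 1 \<Longrightarrow> 6 * m dvd n" using r(3)[of n] by (simp add: card)
    show "6 * m dvd n \<Longrightarrow> r ^ n = 1"
      using fermat[OF r(1)] by (elim dvdE) (simp only: power_mult power_one)
  qed
  thus thesis using that r by blast
qed

lemma cube_root_of_unity:
  obtains \<rho> :: 'a where "\<rho> ^ 2 + \<rho> + 1 = 0" "\<rho> \<noteq> 1"
proof -
  obtain r :: 'a where r: "\<And>n. r ^ n = 1 \<longleftrightarrow> 6 * m dvd n"
    using primitive_root by blast
  define \<rho> where "\<rho> = r ^ (2 * m)"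
  have ne: "\<rho> \<noteq> 1" using r[of "2 * m"] m_pos by (auto simp: \<rho>_def dest: dvd_imp_le)
  have "\<rho> ^ 3 = 1" using r[of "6 * m"] by (simp add: \<rho>_def flip: power_mult)
  hence "(\<rho> - 1) * (\<rho> ^ 2 + \<rho> + 1) = 0"
    by (simp add: algebra_simps power2_eq_square power3_eq_cube)
  hence "\<rho> ^ 2 + \<rho> + 1 = 0" using ne by simp
  thus thesis using that ne by blast
qed

text \<open>The element \<open>r ^ (3 * m)\<close> has order two, but in characteristic 2 only 1
  squares to 1.\<close>

lemma two_nz: "(2 :: 'a) \<noteq> 0"
proof
  assume two: "(2 :: 'a) = 0"
  obtain r :: 'a where r: "\<And>n. r ^ n = 1 \<longleftrightarrow> 6 * m dvd n"
    using primitive_root by blast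
  define s where "s = r ^ (3 * m)"
  have "s \<noteq> 1" using r[of "3 * m"] m_pos by (auto simp: s_def dest: dvd_imp_le)
  have "s ^ 2 = 1" using r[of "6 * m"] by (simp add: s_def flip: power_mult)
  hence "s = - 1" using \<open>s \<noteq> 1\<close> by (simp add: power2_eq_1_iff)
  also have "(- 1 :: 'a) = 1" using two by (simp add: neg_eq_iff_add_eq_0)
  finally show False using \<open>s \<noteq> 1\<close> by simp
qed

text \<open>In characteristic 3 the polynomial \<open>X ^ 2 + X + 1\<close> is
  \<open>(X - 1) ^ 2\<close>, which has no root other than 1.\<close>

lemma three_nz: "(3 :: 'a) \<noteq> 0"
proof
  assume three: "(3 :: 'a) = 0"
  obtain \<rho> :: 'a where \<rho>: "\<rho> ^ 2 + \<rho> + 1 = 0" "\<rho> \<noteq> 1" by (rule cube_root_of_unity)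
  have "(\<rho> - 1) ^ 2 = (\<rho> ^ 2 + \<rho> + 1) - 3 * \<rho>"
    by (simp add: algebra_simps power2_eq_square)
  thus False using \<rho> three by simp
qed

lemma minus_3_square: obtains u :: 'a where "u ^ 2 = - 3"
proof -
  obtain \<rho> :: 'a where \<rho>: "\<rho> ^ 2 + \<rho> + 1 = 0" by (rule cube_root_of_unity)
  have "(2 * \<rho> + 1) ^ 2 = 4 * (\<rho> ^ 2 + \<rho> + 1) - 3"
    by (simp add: algebra_simps power2_eq_square)
  thus thesis using that \<rho> by simp
qed

lemma A_power_6: "x \<noteq> 0 \<Longrightarrow> A x ^ 6 = 1"
  by (metis A_power T_eq_1_iff fermat mult.commute)

text \<open>For \<open>x = r ^ k\<close>, \<open>A x ^ 3 = 1\<close> means that \<open>6 * m\<close>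
  divides \<open>3 * m * k\<close>, so that \<open>k\<close> is even. Otherwise
  \<open>A_power_6\<close> leaves only the value -1.\<close>

lemma A_cube: "A x ^ 3 = quadratic_char x"
proof (cases "x = 0")
  case False
  obtain r :: 'a where r: "r \<noteq> 0" "\<And>x. x \<noteq> 0 \<Longrightarrow> \<exists>k. x = r ^ k"
    "\<And>n. r ^ n = 1 \<longleftrightarrow> 6 * m dvd n"
    using primitive_root by blast
  obtain k where k: "x = r ^ k" using r(2)[OF False] by blast
  have sq: "(\<exists>y. x = y ^ 2) \<longleftrightarrow> A x ^ 3 = 1"
  proof
    assume "\<exists>y. x = y ^ 2"
    then obtain y where y: "x = y ^ 2" by blast
    hence "x ^ (m * 3) = y ^ (6 * m)" by (simp flip: power_mult add: mult.commute)
    thus "A x ^ 3 = 1" using fermat[of y] y False by (simp add: A_power T_eq_1_iff)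
  next
    assume "A x ^ 3 = 1"
    hence "6 * m dvd k * (m * 3)"
      unfolding A_power T_eq_1_iff k power_mult[symmetric] r(3) .
    hence "(3 * m) * 2 dvd (3 * m) * k" by (simp add: mult_ac)
    hence "2 dvd k" using m_pos dvd_times_left_cancel_iff[of "3 * m" 2 k] by simp
    then obtain j where "k = j * 2" by (metis dvdE mult.commute)
    hence "x = (r ^ j) ^ 2" by (simp add: k power_mult)
    thus "\<exists>y. x = y ^ 2" by blast
  qed
  have "(A x ^ 3) ^ 2 = 1"
    using A_power_6[OF False] power_mult[of "A x" 3 2] by simp
  hence "A x ^ 3 = 1 \<or> A x ^ 3 = - 1" by (rule power2_eq_1_iff[THEN iffD1])
  thus ?thesis using False sq by (auto simp: quadratic_char_def)
qed simp

lemma quadratic_char_mult: "quadratic_char (x * y :: 'a) = quadratic_char x * quadratic_char y"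
  by (simp only: A_cube[symmetric] A_mult power_mult_distrib)

lemma A_minus_1: "A (- 1) = quadratic_char (- 1 :: 'a)"
proof -
  have "A (- 1) ^ 2 = 1" using A_mult[of "- 1" "- 1"] by (simp add: A_one power2_eq_square)
  hence "A (- 1) ^ 3 = A (- 1)" by (simp add: power3_eq_cube power2_eq_square)
  thus ?thesis by (metis A_cube)
qed

text \<open>The cubic character \<open>A ^ 4\<close> is 1 exactly at the nonzero cubes; elsewhere it
  is a primitive cube root of unity and the three terms cancel. A nonzero cube has three roots,
  since the field contains \<open>\<rho>\<close>.\<close>

lemma card_cube_roots:
  assumes "x \<noteq> 0"
  shows "of_nat (card {s. s ^ 3 = x}) = 1 + A x ^ 4 + (A x ^ 4) ^ 2"
proof (cases "\<exists>s. x = s ^ 3")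
  case True
  then obtain s where s: "x = s ^ 3" by blast
  hence s0: "s \<noteq> 0" using assms by auto
  obtain \<rho> :: 'a where \<rho>: "\<rho> ^ 2 + \<rho> + 1 = 0" "\<rho> \<noteq> 1" by (rule cube_root_of_unity)
  have \<rho>2: "\<rho> ^ 2 = - \<rho> - 1" using \<rho>(1) by (simp add: eq_neg_iff_add_eq_0 algebra_simps)
  have "z ^ 3 - s ^ 3 = (z - s) * ((z - \<rho> * s) * (z - \<rho> ^ 2 * s))" for z
  proof -
    have "(z - \<rho> * s) * (z - \<rho> ^ 2 * s) = z ^ 2 - (\<rho> + \<rho> ^ 2) * z * s + \<rho> * \<rho> ^ 2 * s ^ 2"
      by (simp add: algebra_simps power2_eq_square)
    also have "\<rho> + \<rho> ^ 2 = - 1" using \<rho>2 by simp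
    also have "\<rho> * \<rho> ^ 2 = - (\<rho> ^ 2) - \<rho>" 
    proof -
      have "\<rho> * \<rho> ^ 2 = \<rho> * (- \<rho> - 1)" by (simp only: \<rho>2)
      thus ?thesis by (simp add: algebra_simps power2_eq_square)
    qed
    also have "\<dots> = 1" by (simp add: \<rho>2)
    finally show ?thesis by (simp add: algebra_simps power2_eq_square power3_eq_cube)
  qed
  hence "z ^ 3 = x \<longleftrightarrow> (z - s) * ((z - \<rho> * s) * (z - \<rho> ^ 2 * s)) = 0" for z
    by (metis s eq_iff_diff_eq_0)
  hence eq: "{z. z ^ 3 = x} = {s, \<rho> * s, \<rho> ^ 2 * s}" by auto
  have "\<rho> \<noteq> 0" using \<rho>(1) by auto
  moreover have "\<rho> ^ 2 \<noteq> 1"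
  proof
    assume "\<rho> ^ 2 = 1"
    hence "\<rho> + 2 = 0" using \<rho>(1) by (simp add: algebra_simps)
    hence "\<rho> = - 2" by (simp only: eq_neg_iff_add_eq_0)
    hence "(3 :: 'a) = 0" using \<rho>(1) by simp
    thus False using three_nz by simp
  qed
  ultimately have "card {s, \<rho> * s, \<rho> ^ 2 * s} = 3"
    using \<rho>(2) s0 by (simp add: power2_eq_square)
  moreover have "A x ^ 4 = 1"
  proof -
    have "x ^ (m * 4) = (s ^ (6 * m)) ^ 2"
      unfolding s power_mult[symmetric] by (simp add: mult_ac)
    thus ?thesis unfolding A_power T_eq_1_iff fermat[OF s0] by simp
  qed
  ultimately show ?thesis unfolding eq by simp
next
  case False
  obtain r :: 'a where r: "\<And>x. x \<noteq> 0 \<Longrightarrow> \<exists>k. x = r ^ k"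
    "\<And>n. r ^ n = 1 \<longleftrightarrow> 6 * m dvd n"
    using primitive_root by blast
  obtain k where k: "x = r ^ k" using r(1)[OF assms] by blast
  have "A x ^ 4 \<noteq> 1"
  proof
    assume "A x ^ 4 = 1"
    hence "6 * m dvd k * (m * 4)"
      unfolding A_power T_eq_1_iff k power_mult[symmetric] r(2) .
    hence "(2 * m) * 3 dvd (2 * m) * (2 * k)" by (simp add: mult_ac)
    hence "3 dvd 2 * k" using m_pos dvd_times_left_cancel_iff[of "2 * m" 3 "2 * k"] by simp
    hence "3 dvd k" by presburger
    then obtain j where "k = j * 3" by (metis dvdE mult.commute)
    hence "x = (r ^ j) ^ 3" by (simp add: k power_mult)
    thus False using False by blast
  qed
  moreover have "(A x ^ 4) ^ 3 = 1"
    using A_power_6[OF assms] power_mult[of "A x" 6 2] power_mult[of "A x" 4 3] by simp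
  hence "(A x ^ 4 - 1) * (1 + A x ^ 4 + (A x ^ 4) ^ 2) = 0"
    by (simp add: algebra_simps power2_eq_square power3_eq_cube)
  ultimately have "1 + A x ^ 4 + (A x ^ 4) ^ 2 = 0" by simp
  moreover have "{s. s ^ 3 = x} = {}" using False by blast
  ultimately show ?thesis by simp
qed

text \<open>Multiplying the variable by a primitive root \<open>r\<close> scales the sum by
  \<open>A r\<close>, which is not 1.\<close>

lemma sum_A: "(\<Sum>x\<in>UNIV. A x) = 0"
proof -
  obtain r :: 'a where r: "r \<noteq> 0" "\<And>n. r ^ n = 1 \<longleftrightarrow> 6 * m dvd n"
    using primitive_root by blast
  have "A r \<noteq> 1"
    using A_power[of r 1] r(2)[of m] m_pos by (auto simp: T_eq_1_iff dest: dvd_imp_le)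
  moreover have "(\<Sum>x\<in>UNIV. A (r * x)) = (\<Sum>x\<in>UNIV. A x)"
    using sum_affine[OF r(1), of A 0] by simp
  hence "(A r - 1) * (\<Sum>x\<in>UNIV. A x) = 0"
    by (simp add: A_mult algebra_simps sum_distrib_left)
  ultimately show ?thesis by simp
qed

subsection \<open>Cubic sums and Greene's series\<close>

lemma sum_cubes:
  fixes G :: "'a \<Rightarrow> complex"
  shows "(\<Sum>s\<in>-{0}. G (s ^ 3)) = (\<Sum>w\<in>-{0}. (1 + A w ^ 4 + (A w ^ 4) ^ 2) * G w)"
proof -
  have "(\<Sum>s\<in>-{0}. G (s ^ 3)) = (\<Sum>w\<in>UNIV. of_nat (card {s\<in>-{0}. s ^ 3 = w}) * G w)"
    by (rule sum_fibres)
  also have "\<dots> = (\<Sum>w\<in>-{0}. of_nat (card {s\<in>-{0}. s ^ 3 = w}) * G w)"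
    by (rule sum.mono_neutral_right) (auto simp: card_eq_0_iff)
  also have "\<dots> = (\<Sum>w\<in>-{0}. (1 + A w ^ 4 + (A w ^ 4) ^ 2) * G w)"
  proof (rule sum.cong)
    fix w :: 'a assume "w \<in> -{0}"
    hence "w \<noteq> 0" by simp
    hence "{s\<in>-{0}. s ^ 3 = w} = {s. s ^ 3 = w}" by auto
    thus "of_nat (card {s\<in>-{0}. s ^ 3 = w}) * G w = (1 + A w ^ 4 + (A w ^ 4) ^ 2) * G w"
      using card_cube_roots[OF \<open>w \<noteq> 0\<close>] by simp
  qed simp
  finally show ?thesis .
qed

lemma four_nz: "(4 :: 'a) \<noteq> 0"
  using two_nz mult_eq_0_iff[of "2 :: 'a" 2] by simp

lemma twenty_seven_nz: "(27 :: 'a) \<noteq> 0"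
  using three_nz power_not_zero[of "3 :: 'a" 3] by simp

text \<open>This is \<open>cubic_fibre\<close> weighted by \<open>F\<close> and summed over
  \<open>t\<close>, rearranged so that both sides carry the weights
  \<open>1 + quadratic_char\<close> that \<open>sum_add_inverse\<close> produces.\<close>

lemma sum_over_cubic:
  fixes F :: "'a \<Rightarrow> complex"
  shows "(\<Sum>x\<in>UNIV. (1 + quadratic_char ((3 * x + 1) ^ 2 - 4)) * F (x ^ 2 * (x + 1))) =
    2 * (\<Sum>x\<in>UNIV. F (x ^ 2 * (x + 1))) - 2 * (\<Sum>t\<in>UNIV. F t) +
    (\<Sum>t\<in>UNIV. (1 + quadratic_char ((27 * t - 2) ^ 2 - 4)) * F t)"
proof -
  obtain u :: 'a where u: "u ^ 2 = - 3" by (rule minus_3_square)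
  have aux: "k + l = 2 * k - 2 * m + (m + n)" if "k - l = m - n" for k l m n :: complex
  proof -
    have "k + l = 2 * k - (k - l)" by simp
    also have "\<dots> = 2 * k - 2 * m + (m + n)" unfolding that by simp
    finally show ?thesis .
  qed
  have "(\<Sum>x\<in>UNIV. (1 - quadratic_char ((3 * x + 1) ^ 2 - 4)) * F (x ^ 2 * (x + 1))) =
      (\<Sum>t\<in>UNIV. \<Sum>x | x ^ 2 * (x + 1) = t.
        (1 - quadratic_char ((3 * x + 1) ^ 2 - 4)) * F (x ^ 2 * (x + 1)))"
    using sum.group[of "UNIV :: 'a set" UNIV "\<lambda>x. x ^ 2 * (x + 1)"
        "\<lambda>x. (1 - quadratic_char ((3 * x + 1) ^ 2 - 4)) * F (x ^ 2 * (x + 1))"] by simp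
  also have "\<dots> = (\<Sum>t\<in>UNIV. (\<Sum>x | x ^ 2 * (x + 1) = t.
        (1 - quadratic_char ((3 * x + 1) ^ 2 - 4))) * F t)"
    unfolding sum_distrib_right by (intro sum.cong) auto
  also have "\<dots> = (\<Sum>t\<in>UNIV. (1 - quadratic_char ((27 * t - 2) ^ 2 - 4)) * F t)"
    unfolding cubic_fibre[OF two_nz three_nz u] ..
  finally show ?thesis
    by (simp only: left_diff_distrib distrib_right mult_1_left sum.distrib sum_subtractf) (erule aux)
qed

text \<open>
  The substitution is \<open>x = (s + 1/s - 1) / 3\<close> and \<open>w = s\<^sup>3\<close>, for which
  \<open>x\<^sup>2 (x + 1) = (w + 1)\<^sup>2 / (27 w)\<close>.
\<close>
lemma sum_twisted_cubic_character:
  fixes F :: "'a \<Rightarrow> complex"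
  shows "(\<Sum>w\<in>-{0}. A w ^ 4 * F ((w + 1) ^ 2 / (27 * w))) =
    (\<Sum>x\<in>UNIV. F (x ^ 2 * (x + 1))) - (\<Sum>t\<in>UNIV. F t)"
proof -
  define G where "G w = F ((w + 1) ^ 2 / (27 * w))" for w
  have "(\<Sum>s\<in>-{0}. G (s ^ 3)) =
      (\<Sum>s\<in>-{0}. (\<lambda>y. F (((y - 1) / 3) ^ 2 * ((y - 1) / 3 + 1))) (s + 1 / s))"
  proof (rule sum.cong)
    fix s :: 'a assume "s \<in> -{0}"
    hence s: "s \<noteq> 0" by simp
    have 1: "(s + 1 / s - 1) / 3 = (s ^ 2 - s + 1) / (3 * s)"
      using s three_nz by (simp add: field_simps power2_eq_square)
    have 2: "(s + 1 / s - 1) / 3 + 1 = (s + 1) ^ 2 / (3 * s)"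
      using s three_nz by (simp add: field_simps power2_eq_square)
    have "(s ^ 2 - s + 1) ^ 2 * (s + 1) ^ 2 = (s ^ 3 + 1) ^ 2"
      by (simp add: algebra_simps power2_eq_square power3_eq_cube)
    moreover have "(3 * s) ^ 2 * (3 * s) = 27 * s ^ 3"
      by (simp add: power2_eq_square power3_eq_cube)
    ultimately show "G (s ^ 3) = (\<lambda>y. F (((y - 1) / 3) ^ 2 * ((y - 1) / 3 + 1))) (s + 1 / s)"
      unfolding G_def 2 unfolding 1 by (simp only: power_divide times_divide_times_eq)
  qed simp
  also have "\<dots> = (\<Sum>y\<in>UNIV. (1 + quadratic_char (y ^ 2 - 4)) * F (((y - 1) / 3) ^ 2 * ((y - 1) / 3 + 1)))"
    by (rule sum_add_inverse[OF two_nz])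
  also have "\<dots> = (\<Sum>x\<in>UNIV. (1 + quadratic_char ((3 * x + 1) ^ 2 - 4)) * F (x ^ 2 * (x + 1)))"
    using sum_affine[OF three_nz, of "\<lambda>y. (1 + quadratic_char (y ^ 2 - 4)) *
      F (((y - 1) / 3) ^ 2 * ((y - 1) / 3 + 1))" 1] three_nz by simp
  finally have cubes: "(\<Sum>s\<in>-{0}. G (s ^ 3)) = \<dots>" .
  \<comment> \<open>The trivial character's part: \<open>(w + 1) ^ 2 / (27 * w)\<close> depends only
    on \<open>w + 1 / w\<close>.\<close>
  have "(\<Sum>w\<in>-{0}. G w) = (\<Sum>w\<in>-{0}. (\<lambda>y. F ((y + 2) / 27)) (w + 1 / w))"
    using twenty_seven_nz
    by (intro sum.cong) (auto simp: G_def field_simps power2_eq_square)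
  also have "\<dots> = (\<Sum>y\<in>UNIV. (1 + quadratic_char (y ^ 2 - 4)) * F ((y + 2) / 27))"
    by (rule sum_add_inverse[OF two_nz])
  also have "\<dots> = (\<Sum>t\<in>UNIV. (1 + quadratic_char ((27 * t - 2) ^ 2 - 4)) * F t)"
    using sum_affine[OF twenty_seven_nz, of "\<lambda>y. (1 + quadratic_char (y ^ 2 - 4)) *
      F ((y + 2) / 27)" "- 2"] twenty_seven_nz by simp
  finally have all: "(\<Sum>w\<in>-{0}. G w) = \<dots>" .
  \<comment> \<open>The inversion of \<open>w\<close> fixes \<open>G\<close> and exchanges the two
    nontrivial cubic characters, so they contribute equally.\<close>
  have "(\<Sum>w\<in>-{0}. (A w ^ 4) ^ 2 * G w) = (\<Sum>w\<in>-{0}. A w ^ 4 * G w)"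
  proof (rule sum.reindex_bij_witness[of _ "\<lambda>w. 1 / w" "\<lambda>w. 1 / w"])
    fix w :: 'a assume "w \<in> -{0}"
    hence w: "w \<noteq> 0" by simp
    have "A (1 / w) * A w = 1" using A_mult[of "1 / w" w] w by (simp add: A_one)
    hence "A (1 / w) ^ 4 * A w ^ 4 = 1" by (metis power_mult_distrib power_one)
    moreover have "A w ^ 4 * (A w ^ 4) ^ 2 = 1"
      using A_power_6[OF w] power_mult[of "A w" 6 2] by (simp flip: power_mult power_add)
    moreover have "A w ^ 4 \<noteq> 0" using w by (simp add: A_zero_iff)
    ultimately have "A (1 / w) ^ 4 = (A w ^ 4) ^ 2"
      by (metis mult.commute mult_left_cancel)
    moreover have "G (1 / w) = G w"
      using w twenty_seven_nz
      by (auto simp: G_def field_simps power2_eq_square intro!: arg_cong[of _ _ F])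
    ultimately show "A (1 / w) ^ 4 * G (1 / w) = (A w ^ 4) ^ 2 * G w" by simp
  qed auto
  moreover have "(\<Sum>w\<in>-{0}. (1 + A w ^ 4 + (A w ^ 4) ^ 2) * G w) =
      (\<Sum>w\<in>-{0}. G w) + (\<Sum>w\<in>-{0}. A w ^ 4 * G w) + (\<Sum>w\<in>-{0}. (A w ^ 4) ^ 2 * G w)"
    by (simp only: distrib_right mult_1_left sum.distrib)
  ultimately have "2 * (\<Sum>w\<in>-{0}. A w ^ 4 * G w) = (\<Sum>s\<in>-{0}. G (s ^ 3)) - (\<Sum>w\<in>-{0}. G w)"
    using sum_cubes[of G] by simp
  also have "\<dots> = 2 * ((\<Sum>x\<in>UNIV. F (x ^ 2 * (x + 1))) - (\<Sum>t\<in>UNIV. F t))"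
    unfolding cubes all sum_over_cubic by simp
  finally show ?thesis unfolding G_def by (simp only: mult_cancel_left) simp
qed

text \<open>As \<open>A\<close> sums to zero, the quadratic character may be replaced by a count of
  the roots \<open>y\<close>. After interchanging the sums, \<open>y\<close> determines
  \<open>w\<close> as \<open>(1 - y) / (y * (1 - \<mu> * y))\<close>.\<close>

lemma sum_quadratic_twist:
  assumes \<mu>: "\<mu> \<noteq> 0"
  shows "(\<Sum>w\<in>UNIV. A w * quadratic_char ((w + 1) ^ 2 - 4 * \<mu> * w)) =
    (\<Sum>y\<in>UNIV. inverse (A y) * A (1 - y) * inverse (A (1 - \<mu> * y)))"
proof -
  have root: "\<mu> * w * y ^ 2 + (- (w + 1)) * y + 1 = 0 \<longleftrightarrow> w * (y * (1 - \<mu> * y)) = 1 - y" for w y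
  proof -
    have "\<mu> * w * y ^ 2 + (- (w + 1)) * y + 1 = (1 - y) - w * (y * (1 - \<mu> * y))"
      by (simp add: algebra_simps power2_eq_square)
    thus ?thesis by (metis eq_iff_diff_eq_0)
  qed
  have "(\<Sum>w\<in>UNIV. A w * quadratic_char ((w + 1) ^ 2 - 4 * \<mu> * w)) =
      (\<Sum>w\<in>UNIV. A w * (1 + quadratic_char ((w + 1) ^ 2 - 4 * \<mu> * w)))"
    by (simp add: ring_distribs sum.distrib sum_A)
  also have "\<dots> = (\<Sum>w\<in>UNIV. A w * of_nat (card {y. w * (y * (1 - \<mu> * y)) = 1 - y}))"
  proof (rule sum.cong)
    fix w :: 'a
    show "A w * (1 + quadratic_char ((w + 1) ^ 2 - 4 * \<mu> * w)) =
      A w * of_nat (card {y. w * (y * (1 - \<mu> * y)) = 1 - y})"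
    proof (cases "w = 0")
      case False
      hence "\<mu> * w \<noteq> 0" using \<mu> by simp
      from card_quadratic_roots[OF two_nz this, of "- (w + 1)" 1] show ?thesis
        unfolding root power2_minus by (simp only: mult.assoc mult_1_right)
    qed simp
  qed simp
  also have "\<dots> = (\<Sum>w\<in>UNIV. \<Sum>y\<in>UNIV. if w * (y * (1 - \<mu> * y)) = 1 - y then A w else 0)"
    by (simp add: sum.If_cases mult.commute)
  also have "\<dots> = (\<Sum>y\<in>UNIV. \<Sum>w\<in>UNIV. if w * (y * (1 - \<mu> * y)) = 1 - y then A w else 0)"
    by (rule sum.swap)
  also have "\<dots> = (\<Sum>y\<in>UNIV. inverse (A y) * A (1 - y) * inverse (A (1 - \<mu> * y)))"
  proof (rule sum.cong)
    fix y :: 'a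
    define v where "v = y * (1 - \<mu> * y)"
    show "(\<Sum>w\<in>UNIV. if w * (y * (1 - \<mu> * y)) = 1 - y then A w else 0) =
      inverse (A y) * A (1 - y) * inverse (A (1 - \<mu> * y))"
    proof (cases "v = 0")
      \<comment> \<open>Either no \<open>w\<close> fits or, for \<open>y = 1\<close>, every
        \<open>w\<close> does and \<open>sum_A\<close> applies. The right side vanishes because
        \<open>inverse 0 = 0\<close>.\<close>
      case True
      hence "(\<Sum>w\<in>UNIV. if w * (y * (1 - \<mu> * y)) = 1 - y then A w else 0) = 0"
        using sum_A by (cases "1 - y = 0") (auto simp: v_def)
      moreover have "inverse (A y) * inverse (A (1 - \<mu> * y)) = 0"
        using True by (auto simp: v_def)
      ultimately show ?thesis by auto
    next
      case False
      hence "w * v = 1 - y \<longleftrightarrow> w = (1 - y) / v" for w by (simp add: field_simps)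
      hence "(\<Sum>w\<in>UNIV. if w * (y * (1 - \<mu> * y)) = 1 - y then A w else 0) = A ((1 - y) / v)"
        by (simp flip: v_def)
      moreover have "A ((1 - y) / v) * (A y * A (1 - \<mu> * y)) = A (1 - y)"
        using False by (simp flip: A_mult v_def)
      moreover have "A y \<noteq> 0" "A (1 - \<mu> * y) \<noteq> 0" using False by (auto simp: v_def A_zero_iff)
      ultimately show ?thesis by (simp add: field_simps)
    qed
  qed simp
  finally show ?thesis .
qed

lemma sum_quadratic_char_cubic:
  assumes d: "d \<noteq> 0" and e: "e \<noteq> 0"
  defines "\<mu> \<equiv> - (3 ^ 3 * e) / (2 ^ 2 * d ^ 3)"
  shows "(\<Sum>x\<in>UNIV. quadratic_char (x ^ 3 + d * x ^ 2 + e)) =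
    quadratic_char (3 * d) *
    (\<Sum>y\<in>UNIV. inverse (A y) * A (1 - y) * inverse (A (1 - \<mu> * y)))"
proof -
  define e' where "e' = e / d ^ 3"
  have \<mu>0: "\<mu> \<noteq> 0" using d e four_nz twenty_seven_nz by (simp add: \<mu>_def)
  have \<mu>e': "4 * \<mu> = - (27 * e')" using d four_nz by (simp add: \<mu>_def e'_def field_simps)
  have "(\<Sum>x\<in>UNIV. quadratic_char (x ^ 3 + d * x ^ 2 + e)) =
      (\<Sum>x\<in>UNIV. quadratic_char ((d * x) ^ 3 + d * (d * x) ^ 2 + e))"
    using sum_affine[OF d, of "\<lambda>x. quadratic_char (x ^ 3 + d * x ^ 2 + e)" 0] by simp
  also have "\<dots> = (\<Sum>x\<in>UNIV. quadratic_char d * quadratic_char (x ^ 2 * (x + 1) + e'))"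
  proof (rule sum.cong)
    fix x :: 'a
    have "(d * x) ^ 3 + d * (d * x) ^ 2 + e = d ^ 2 * (d * (x ^ 2 * (x + 1) + e'))"
      using d by (simp add: e'_def field_simps power2_eq_square power3_eq_cube)
    thus "quadratic_char ((d * x) ^ 3 + d * (d * x) ^ 2 + e) =
        quadratic_char d * quadratic_char (x ^ 2 * (x + 1) + e')"
      using quadratic_char_mult_square[OF d] by (simp add: quadratic_char_mult)
  qed simp
  also have "\<dots> = quadratic_char d * (\<Sum>x\<in>UNIV. quadratic_char (x ^ 2 * (x + 1) + e'))"
    by (simp add: sum_distrib_left)
  \<comment> \<open>The correction term of \<open>sum_twisted_cubic_character\<close> is a full sum
    of the quadratic character, which is zero.\<close>
  also have "(\<Sum>x\<in>UNIV. quadratic_char (x ^ 2 * (x + 1) + e')) =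
      (\<Sum>w\<in>-{0}. A w ^ 4 * quadratic_char ((w + 1) ^ 2 / (27 * w) + e'))"
    using sum_twisted_cubic_character[of "\<lambda>t. quadratic_char (t + e')"]
      sum_affine[of "1 :: 'a" quadratic_char e'] sum_quadratic_char[OF two_nz] by simp
  also have "\<dots> = (\<Sum>w\<in>-{0}. quadratic_char (3 :: 'a) * (A w * quadratic_char ((w + 1) ^ 2 - 4 * \<mu> * w)))"
  proof (rule sum.cong)
    fix w :: 'a assume "w \<in> -{0}"
    hence w: "w \<noteq> 0" by simp
    have 9: "(9 * w) \<noteq> 0" using w three_nz mult_eq_0_iff[of "3 :: 'a" 3] by simp
    have "(9 * w) ^ 2 * ((w + 1) ^ 2 / (27 * w) + e') = 3 * w * ((w + 1) ^ 2 + 27 * e' * w)"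
      using w twenty_seven_nz by (simp add: field_simps power2_eq_square)
    also have "(w + 1) ^ 2 + 27 * e' * w = (w + 1) ^ 2 - 4 * \<mu> * w" unfolding \<mu>e' by simp
    finally have eq: "(9 * w) ^ 2 * ((w + 1) ^ 2 / (27 * w) + e') = 3 * w * ((w + 1) ^ 2 - 4 * \<mu> * w)" .
    have "quadratic_char ((w + 1) ^ 2 / (27 * w) + e') =
        quadratic_char (3 :: 'a) * quadratic_char w * quadratic_char ((w + 1) ^ 2 - 4 * \<mu> * w)"
      using quadratic_char_mult_square[OF 9, of "(w + 1) ^ 2 / (27 * w) + e'"]
      unfolding eq by (simp only: quadratic_char_mult)
    \<comment> \<open>The cubic character times the quadratic one is \<open>A ^ 7\<close>, which
      equals \<open>A\<close>.\<close>
    moreover have "A w ^ 4 * A w ^ 3 = A w ^ 6 * A w"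
      by (simp add: eval_nat_numeral)
    hence "A w ^ 4 * quadratic_char w = A w" using A_power_6[OF w] by (simp add: A_cube)
    ultimately show "A w ^ 4 * quadratic_char ((w + 1) ^ 2 / (27 * w) + e') =
        quadratic_char (3 :: 'a) * (A w * quadratic_char ((w + 1) ^ 2 - 4 * \<mu> * w))" by simp
  qed simp
  also have "\<dots> = (\<Sum>w\<in>UNIV. quadratic_char (3 :: 'a) * (A w * quadratic_char ((w + 1) ^ 2 - 4 * \<mu> * w)))"
    by (rule sum.mono_neutral_left) auto
  also have "\<dots> = quadratic_char (3 :: 'a) *
      (\<Sum>y\<in>UNIV. inverse (A y) * A (1 - y) * inverse (A (1 - \<mu> * y)))"
    unfolding sum_distrib_left[symmetric] sum_quadratic_twist[OF \<mu>0] ..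
  finally show ?thesis by (simp add: quadratic_char_mult)
qed

text \<open>The upper characters are \<open>A\<close> and its inverse, so the sum over
  \<open>y\<close> is the one in Greene's series. The prefactor at -1 equals
  \<open>quadratic_char (- 1)\<close> and accounts for the sign in \<open>- 3 * d\<close>.\<close>

lemma sum_quadratic_char_cubic_hyp_2F1:
  assumes d: "d \<noteq> 0" and e: "e \<noteq> 0"
  shows "(\<Sum>x\<in>UNIV. quadratic_char (x ^ 3 + d * x ^ 2 + e)) =
    of_nat CARD('a) * quadratic_char (- 3 * d) *
      hyp_2F1 (T [^]\<^bsub>char_group\<^esub> m) (T [^]\<^bsub>char_group\<^esub> (5 * m))
        trivial_char (- (3 ^ 3 * e) / (2 ^ 2 * d ^ 3))"
proof -
  define \<mu> where "\<mu> = - (3 ^ 3 * e) / (2 ^ 2 * d ^ 3)"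
  have "\<mu> \<noteq> 0"
    using d e four_nz twenty_seven_nz by (simp add: \<mu>_def)
  have TA: "T [^]\<^bsub>char_group\<^esub> m = A" "T [^]\<^bsub>char_group\<^esub> (5 * m) = (\<lambda>x. inverse (A x))"
  proof -
    show "T [^]\<^bsub>char_group\<^esub> m = A"
      using char_group_nat_pow[OF T_char m_pos] by (simp add: A_def)
    have "T x ^ (5 * m) = inverse (A x)" for x
    proof (cases "x = 0")
      case True
      thus ?thesis using m_pos mult_char_zero_iff[OF T_mult_char, of x] by simp
    next
      case False
      have "T x ^ (5 * m) * A x = 1"
        using A_power_6[OF False] by (simp add: A_def flip: power_mult power_add) (simp add: mult.commute)
      thus ?thesis by (metis inverse_unique mult.commute)
    qed
    thus "T [^]\<^bsub>char_group\<^esub> (5 * m) = (\<lambda>x. inverse (A x))"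
      using char_group_nat_pow[OF T_char, of "5 * m"] m_pos by simp
  qed
  have A': "mult_char (\<lambda>x. inverse (A x))" by (rule mult_char_inverse[OF A_mult_char])
  have triv: "inverse (A x) * trivial_char x = inverse (A x)" "A x * trivial_char x = A x" for x
    by (simp_all add: trivial_char_def)
  have "hyp_2F1 (T [^]\<^bsub>char_group\<^esub> m) (T [^]\<^bsub>char_group\<^esub> (5 * m)) trivial_char \<mu> =
      (inverse (A (- 1)) / of_nat CARD('a)) *
      (\<Sum>y\<in>UNIV. inverse (A y) * A (1 - y) * inverse (A (1 - \<mu> * y)))"
    using \<open>\<mu> \<noteq> 0\<close>
    by (simp add: hyp_2F1_def TA inv_char_group[OF A'] inv_char_group[OF A_mult_char])
       (simp add: char_group_def triv trivial_char_def[of \<mu>])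
  moreover have "quadratic_char (3 * d) = quadratic_char (- 3 * d) * inverse (A (- 1))"
  proof -
    have "quadratic_char (- 3 * d) = A (- 1) * quadratic_char (3 * d)"
      using quadratic_char_mult[of "- 1" "3 * d"] by (simp add: A_minus_1)
    thus ?thesis by (simp add: A_zero_iff)
  qed
  ultimately show ?thesis
    unfolding sum_quadratic_char_cubic[OF d e] \<mu>_def[symmetric] by simp
qed


section \<open>Translation to a critical point and splitting of the sum\<close>

lemma sum_monic_cubic:
  fixes s\<^sub>1 s\<^sub>2 s\<^sub>3 h :: 'a
  assumes h: "3 * h ^ 2 + 2 * s\<^sub>1 * h + s\<^sub>2 = 0"
    and d: "3 * h + s\<^sub>1 \<noteq> 0" and e: "h ^ 3 + s\<^sub>1 * h ^ 2 + s\<^sub>2 * h + s\<^sub>3 \<noteq> 0"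
  shows "(\<Sum>x\<in>UNIV. quadratic_char (x ^ 3 + s\<^sub>1 * x ^ 2 + s\<^sub>2 * x + s\<^sub>3)) =
    of_nat CARD('a) * quadratic_char (- 3 * (3 * h + s\<^sub>1)) *
      hyp_2F1 (T [^]\<^bsub>char_group\<^esub> m) (T [^]\<^bsub>char_group\<^esub> (5 * m)) trivial_char
        (- (3 ^ 3 * (h ^ 3 + s\<^sub>1 * h ^ 2 + s\<^sub>2 * h + s\<^sub>3)) / (2 ^ 2 * (3 * h + s\<^sub>1) ^ 3))"
proof -
  let ?P = "\<lambda>x. x ^ 3 + s\<^sub>1 * x ^ 2 + s\<^sub>2 * x + s\<^sub>3"
  \<comment> \<open>The linear coefficient after translation is the derivative of \<open>?P\<close>
    at \<open>h\<close>, zero by assumption.\<close>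
  have shift: "?P (1 * x + h) = x ^ 3 + (3 * h + s\<^sub>1) * x ^ 2 + ?P h" for x
  proof -
    have "?P (1 * x + h) =
        x ^ 3 + (3 * h + s\<^sub>1) * x ^ 2 + (3 * h ^ 2 + 2 * s\<^sub>1 * h + s\<^sub>2) * x + ?P h"
      by (simp add: algebra_simps power2_eq_square power3_eq_cube)
    thus ?thesis by (simp add: h)
  qed
  have "(\<Sum>x\<in>UNIV. quadratic_char (?P x)) = (\<Sum>x\<in>UNIV. quadratic_char (?P (1 * x + h)))"
    by (rule sum_affine[of 1 "\<lambda>x. quadratic_char (?P x)" h, symmetric]) simp
  also have "\<dots> = (\<Sum>x\<in>UNIV. quadratic_char (x ^ 3 + (3 * h + s\<^sub>1) * x ^ 2 + ?P h))"
    unfolding shift ..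
  finally show ?thesis unfolding sum_quadratic_char_cubic_hyp_2F1[OF d e] .
qed

text \<open>
  The even part of the sum over \<open>x\<close> is a sum over \<open>t = x\<^sup>2\<close>; the odd part becomes the second
  cubic sum under \<open>t = a / r\<close>, the missing value \<open>r = 0\<close> contributing \<open>-1\<close>.
\<close>
lemma psi_222_eq_cubic_sums:
  fixes a b c :: 'a
  assumes a: "a \<noteq> 0" and b: "b \<noteq> 0" and c: "c \<noteq> 0"
  shows "psi_222 a b c = - 1 + (\<Sum>t\<in>UNIV. quadratic_char ((t + a) * (t + b) * (t + c))) +
    quadratic_char (b * c) * (\<Sum>r\<in>UNIV. quadratic_char ((r + 1) * (r + a / b) * (r + a / c)))"
proof -
  let ?P = "\<lambda>t. (t + a) * (t + b) * (t + c)"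
  let ?Q = "\<lambda>r. (r + 1) * (r + a / b) * (r + a / c)"
  have bc: "b * c \<noteq> 0" using b c by simp
  have "psi_222 a b c = (\<Sum>x\<in>UNIV. (\<lambda>t. quadratic_char (?P t)) (x ^ 2))"
    by (simp add: psi_222_def quadratic_char_mult)
  also have "\<dots> = (\<Sum>t\<in>UNIV. (1 + quadratic_char t) * quadratic_char (?P t))"
    by (subst sum_fibres) (simp add: card_square_roots[OF two_nz])
  also have "\<dots> = (\<Sum>t\<in>UNIV. quadratic_char (?P t)) + (\<Sum>t\<in>UNIV. quadratic_char (t * ?P t))"
  proof -
    have "(1 + quadratic_char t) * quadratic_char (?P t) =
        quadratic_char (?P t) + quadratic_char (t * ?P t)" for t
      unfolding quadratic_char_mult[of t "?P t"]
      using distrib_right[of 1 "quadratic_char t" "quadratic_char (?P t)"] by (simp only: mult_1_left)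
    thus ?thesis by (simp only: sum.distrib)
  qed
  also have "(\<Sum>t\<in>UNIV. quadratic_char (t * ?P t)) = (\<Sum>t\<in>-{0}. quadratic_char (t * ?P t))"
    by (rule sum.mono_neutral_right) auto
  also have "\<dots> = (\<Sum>r\<in>-{0}. quadratic_char (b * c) * quadratic_char (?Q r))"
  proof (rule sum.reindex_bij_witness[of _ "\<lambda>r. a / r" "\<lambda>t. a / t"])
    fix t assume "t \<in> - {0 :: 'a}"
    hence t: "t \<noteq> 0" by simp
    have f: "t * (a / t + 1) = t + a" "b * (a / t + a / b) * t = a * (t + b)"
      "c * (a / t + a / c) * t = a * (t + c)"
      using t b c by (simp_all add: field_simps)
    \<comment> \<open>The square factors on both sides clear the denominators of
      \<open>r = a / t\<close> and are invisible to the quadratic character.\<close>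
    have "(a * t) ^ 2 * (t * ?P t) = t ^ 3 * ((t + a) * (a * (t + b)) * (a * (t + c)))"
      by (simp add: power2_eq_square power3_eq_cube mult_ac)
    also have "\<dots> = (t ^ 3) ^ 2 * (b * c * ?Q (a / t))"
      unfolding f[symmetric] by (simp add: power2_eq_square power3_eq_cube mult_ac)
    finally have eq: "(a * t) ^ 2 * (t * ?P t) = (t ^ 3) ^ 2 * (b * c * ?Q (a / t))" .
    have "quadratic_char (t * ?P t) = quadratic_char ((a * t) ^ 2 * (t * ?P t))"
      using a t by (intro quadratic_char_mult_square[symmetric]) simp
    also have "\<dots> = quadratic_char (b * c * ?Q (a / t))"
      unfolding eq using t by (intro quadratic_char_mult_square) simp
    finally show "quadratic_char (b * c) * quadratic_char (?Q (a / t)) = quadratic_char (t * ?P t)"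
      by (simp only: quadratic_char_mult[of "b * c"])
  qed (use a in auto)
  also have "\<dots> = quadratic_char (b * c) * (\<Sum>r\<in>UNIV. quadratic_char (?Q r)) -
      quadratic_char (b * c) * quadratic_char (?Q 0)"
    by (simp add: sum_distrib_left sum_diff1 Compl_eq_Diff_UNIV)
  also have "quadratic_char (b * c) * quadratic_char (?Q 0) = quadratic_char (a ^ 2)"
    using bc by (simp add: power2_eq_square flip: quadratic_char_mult)
  finally show ?thesis using a by simp
qed

end

theorem theorem1p5:
  fixes T :: "'a::finite_field \<Rightarrow> complex"
    and a b c d e f g h :: 'a
    and q :: nat
  assumes q: "q = CARD('a)"
    and odd_char: "odd (CHAR('a))"
    and q_mod_6: "q mod 6 = 1"
    and T_char: "T \<in> carrier char_group"
    and T_generator: "generate char_group {T} = carrier char_group"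
    and h_nonzero: "h \<noteq> 0"
    and h_root1: "3 * h ^ 2 + 2 * ((a * b + b * c + c * a) / (b * c)) * h
                    + (a * b + c * a + a ^ 2) / (b * c) = 0"
    and h_root2: "3 * h ^ 2 + 2 * (a + b + c) * h + (a * b + b * c + c * a) = 0"
    and d: "d = 3 * h + a + b + c"
    and e: "e = h ^ 3 + (a + b + c) * h ^ 2 + (a * b + b * c + c * a) * h + a * b * c"
    and f: "f = 3 * h + (a * b + b * c + c * a) / (b * c)"
    and g: "g = h ^ 3 + ((a * b + b * c + c * a) / (b * c)) * h ^ 2
                  + ((a * b + c * a + a ^ 2) / (b * c)) * h + a ^ 2 / (b * c)"
    and nonzero: "0 \<notin> {a, b, c, d, e, f}"
    and pairwise_distinct: "distinct [a, b, c, d, e, f]"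
  shows "psi_222 a b c =
    - 1
    + of_nat q * quadratic_char (- 3 * d) *
        hyp_2F1 (T [^]\<^bsub>char_group\<^esub> ((q - 1) div 6)) (T [^]\<^bsub>char_group\<^esub> (5 * (q - 1) div 6))
          trivial_char (- (3 ^ 3 * e) / (2 ^ 2 * d ^ 3))
    + of_nat q * quadratic_char (b * c) * quadratic_char (- 3 * f) *
        hyp_2F1 (T [^]\<^bsub>char_group\<^esub> ((q - 1) div 6)) (T [^]\<^bsub>char_group\<^esub> (5 * (q - 1) div 6))
          trivial_char (- (3 ^ 3 * g) / (2 ^ 2 * f ^ 3))"
proof -
  define m where "m = (q - 1) div 6"
  have card: "CARD('a) = 6 * m + 1"
    using q q_mod_6 by (simp add: m_def) presburger
  interpret generating_char T m "\<lambda>x. T x ^ m"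
    by unfold_locales (use card T_char T_generator in auto)
  have exponents: "(q - 1) div 6 = m" "5 * (q - 1) div 6 = 5 * m"
    using card q by simp_all
  have nz: "a \<noteq> 0" "b \<noteq> 0" "c \<noteq> 0" "d \<noteq> 0" "e \<noteq> 0" "f \<noteq> 0" using nonzero by auto
  have ne: "a \<noteq> b" "a \<noteq> c" "b \<noteq> c" using pairwise_distinct by auto
  define s\<^sub>1 where "s\<^sub>1 = (a * b + b * c + c * a) / (b * c)"
  define s\<^sub>2 where "s\<^sub>2 = (a * b + c * a + a ^ 2) / (b * c)"
  define s\<^sub>3 where "s\<^sub>3 = a ^ 2 / (b * c)"
  \<comment> \<open>These are the elementary symmetric functions of 1, \<open>a / b\<close> and
    \<open>a / c\<close>.\<close>
  have s: "s\<^sub>1 = 1 + a / b + a / c" "s\<^sub>2 = a / b + a / c + (a / b) * (a / c)"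
    "s\<^sub>3 = (a / b) * (a / c)"
    using nz by (simp_all add: s\<^sub>1_def s\<^sub>2_def s\<^sub>3_def field_simps power2_eq_square)
  have Q: "(r + 1) * (r + a / b) * (r + a / c) = r ^ 3 + s\<^sub>1 * r ^ 2 + s\<^sub>2 * r + s\<^sub>3" for r
  proof -
    have "(r + 1) * (r + u) * (r + v) = r ^ 3 + (1 + u + v) * r ^ 2 + (u + v + u * v) * r + u * v" for u v
      by (simp add: algebra_simps power2_eq_square power3_eq_cube)
    thus ?thesis unfolding s .
  qed
  have P: "(t + a) * (t + b) * (t + c) =
      t ^ 3 + (a + b + c) * t ^ 2 + (a * b + b * c + c * a) * t + a * b * c" for t
    by (simp add: algebra_simps power2_eq_square power3_eq_cube)
  \<comment> \<open>\<open>g\<close> is the second cubic evaluated at \<open>h\<close>, a zero of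
    its derivative. If it vanished, \<open>h\<close> would be a double root, but the roots -1,
    \<open>- a / b\<close> and \<open>- a / c\<close> are distinct.\<close>
  have "g \<noteq> 0"
  proof
    assume "g = 0"
    hence "(h + 1) * (h + a / b) * (h + a / c) = 0"
      unfolding Q by (simp add: g s\<^sub>1_def s\<^sub>2_def s\<^sub>3_def)
    moreover have "(h + a / b) * (h + a / c) + (h + 1) * (h + a / c) + (h + 1) * (h + a / b) = 0"
    proof -
      have "(h + a / b) * (h + a / c) + (h + 1) * (h + a / c) + (h + 1) * (h + a / b) =
          3 * h ^ 2 + 2 * s\<^sub>1 * h + s\<^sub>2"
      proof -
        have "(h + u) * (h + v) + (h + 1) * (h + v) + (h + 1) * (h + u) =
            3 * h ^ 2 + 2 * (1 + u + v) * h + (u + v + u * v)" for u v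
          by (simp add: algebra_simps power2_eq_square)
        thus ?thesis unfolding s .
      qed
      thus ?thesis using h_root1 by (simp add: s\<^sub>1_def s\<^sub>2_def)
    qed
    moreover have "a / b \<noteq> 1" "a / c \<noteq> 1" "a / b \<noteq> a / c" using nz ne by (auto simp: field_simps)
    ultimately show False by (auto simp: eq_neg_iff_add_eq_0[symmetric])
  qed
  have "(\<Sum>t\<in>UNIV. quadratic_char ((t + a) * (t + b) * (t + c))) =
      of_nat q * quadratic_char (- 3 * d) *
        hyp_2F1 (T [^]\<^bsub>char_group\<^esub> m) (T [^]\<^bsub>char_group\<^esub> (5 * m)) trivial_char
          (- (3 ^ 3 * e) / (2 ^ 2 * d ^ 3))"
    using sum_monic_cubic[of h "a + b + c" "a * b + b * c + c * a" "a * b * c"] h_root2 nz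
    unfolding P q d e by (simp add: add.assoc)
  moreover have "(\<Sum>r\<in>UNIV. quadratic_char ((r + 1) * (r + a / b) * (r + a / c))) =
      of_nat q * quadratic_char (- 3 * f) *
        hyp_2F1 (T [^]\<^bsub>char_group\<^esub> m) (T [^]\<^bsub>char_group\<^esub> (5 * m)) trivial_char
          (- (3 ^ 3 * g) / (2 ^ 2 * f ^ 3))"
    using sum_monic_cubic[of h s\<^sub>1 s\<^sub>2 s\<^sub>3] h_root1 nz \<open>g \<noteq> 0\<close>
    unfolding Q q f g s\<^sub>1_def[symmetric] s\<^sub>2_def[symmetric] s\<^sub>3_def[symmetric] by blast
  ultimately show ?thesis
    unfolding psi_222_eq_cubic_sums[OF nz(1-3)] exponents by (simp only: mult.assoc mult.left_commute)
qed

end
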